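(* For every coloring of the edges of $K_{12}$ with two colors red and blue, the red graph (on all 12 vertices, with the red edges) or the blue graph (on all 12 vertices, with the blue edges) contains an induced subgraph isomorphic to one of $K_4$, $K_{3,2}$, $K_6\setminus C_5$, $K_6\setminus H_6$, or $K_7\setminus H_7$.
   Context: $C_5$ is the 5-cycle. $H_6$ is the graph on vertices $1,\dots,6$ with edges $12,23,34,45,51,26,56$. $H_7$ is the graph on vertices $1,\dots,7$ with edges $12,23,31,14,25,36,47,57,67$. For a graph $H$ on $n$ vertices, $K_n\setminus H$ denotes its complement on the same vertex set; $K_6\setminus C_5$ is the graph on 6 vertices obtained from $K_6$ by deleting the edges of a 5-cycle on 5 of its vertices. $K_{3,2}$ is the complete bipartite graph with parts of sizes 3 and 2. *)

theory Defs
  imports "Graph_Theory.Graph_Theory"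
begin

text \<open>
  As in \<^theory>\<open>Graph_Theory.Digraph\<close>, an undirected simple graph is a symmetric loop-free digraph
  without parallel arcs. The following graph has vertex set \<open>V\<close> and its undirected edges are the
  two-element sets in \<open>E\<close>.
\<close>

definition ugraph :: "'a set \<Rightarrow> 'a set set \<Rightarrow> 'a pair_pre_digraph" where
  "ugraph V E = \<lparr> pverts = V, parcs = {(u, v). u \<noteq> v \<and> {u, v} \<in> E} \<rparr>"

definition complete_edges :: "nat \<Rightarrow> nat set set" where
  "complete_edges n = {e. e \<subseteq> {1..n} \<and> card e = 2}"

definition complete_graph :: "nat \<Rightarrow> nat pair_pre_digraph" where
  "complete_graph n = ugraph {1..n} (complete_edges n)"

definition complete_bipartite_graph :: "nat \<Rightarrow> nat \<Rightarrow> nat pair_pre_digraph" where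
  "complete_bipartite_graph m n =
     ugraph {1..m+n} {{u, v} | u v. u \<in> {1..m} \<and> v \<in> {m+1..m+n}}"

definition C5 :: "nat pair_pre_digraph" where
  "C5 = ugraph {1..5} {{1,2}, {2,3}, {3,4}, {4,5}, {5,1}}"

definition H6 :: "nat pair_pre_digraph" where
  "H6 = ugraph {1..6} {{1,2}, {2,3}, {3,4}, {4,5}, {5,1}, {2,6}, {5,6}}"

definition H7 :: "nat pair_pre_digraph" where
  "H7 = ugraph {1..7} {{1,2}, {2,3}, {3,1}, {1,4}, {2,5}, {3,6}, {4,7}, {5,7}, {6,7}}"

text \<open>
  \<open>delete_edges G H\<close> deletes the edges of \<open>H\<close> from \<open>G\<close> and keeps all vertices of \<open>G\<close>. If \<open>G\<close> is the
  complete graph on the vertex set of \<open>H\<close>, this is the complement of \<open>H\<close>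
  (lemma \<open>delete_edges_complete_graph\<close> below).
\<close>

definition delete_edges :: "'a pair_pre_digraph \<Rightarrow> 'a pair_pre_digraph \<Rightarrow> 'a pair_pre_digraph" where
  "delete_edges G H = \<lparr> pverts = pverts G, parcs = parcs G - parcs H \<rparr>"

definition has_induced_copy :: "'a pair_pre_digraph \<Rightarrow> 'b pair_pre_digraph \<Rightarrow> bool" where
  "has_induced_copy G F \<longleftrightarrow>
     (\<exists>S. induced_subgraph S (with_proj G) \<and> digraph_iso S (with_proj F))"

datatype colour = Red | Blue

text \<open>
  A 2-colouring of the edges of the complete graph on \<open>{1..n}\<close> is given by \<open>c :: nat set \<Rightarrow> colour\<close>;
  only its values on \<open>complete_edges n\<close> matter.
\<close>

definition colour_graph :: "nat \<Rightarrow> (nat set \<Rightarrow> colour) \<Rightarrow> colour \<Rightarrow> nat pair_pre_digraph" where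
  "colour_graph n c k = ugraph {1..n} {e \<in> complete_edges n. c e = k}"


lemma pair_graph_ugraph:
  assumes "finite V" "\<And>e. e \<in> E \<Longrightarrow> e \<subseteq> V"
  shows "pair_graph (ugraph V E)"
proof -
  have sub: "parcs (ugraph V E) \<subseteq> V \<times> V"
    using assms(2) by (auto simp: ugraph_def)
  then have "finite (parcs (ugraph V E))"
    using assms(1) by (meson finite_SigmaI finite_subset)
  moreover have "pverts (ugraph V E) = V"
    by (simp add: ugraph_def)
  moreover have "fst e \<noteq> snd e" "(snd e, fst e) \<in> parcs (ugraph V E)"
    if "e \<in> parcs (ugraph V E)" for e
    using that by (auto simp: ugraph_def insert_commute)
  ultimately show ?thesis
    using assms(1) sub
    by unfold_locales (auto simp: symmetric_def intro!: symI)
qed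

lemma pair_graph_colour_graph: "pair_graph (colour_graph n c k)"
  unfolding colour_graph_def by (rule pair_graph_ugraph) (auto simp: complete_edges_def)

lemma parcs_complete_graph:
  "parcs (complete_graph n) = {(u, v). u \<in> {1..n} \<and> v \<in> {1..n} \<and> u \<noteq> v}"
  by (auto simp: complete_graph_def ugraph_def complete_edges_def)

lemma complete_digraph_complete_graph: "complete_digraph n (with_proj (complete_graph n))"
  unfolding complete_digraph_pair_def parcs_complete_graph
  by (auto simp: complete_graph_def ugraph_def)

lemma complete_bipartite_digraph_complete_bipartite_graph:
  "complete_bipartite_digraph m n (with_proj (complete_bipartite_graph m n))"
  unfolding complete_bipartite_digraph_pair_def
proof (intro conjI exI)
  show "pverts (complete_bipartite_graph m n) = {1..m} \<union> {m+1..m+n}"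
    by (auto simp: complete_bipartite_graph_def ugraph_def)
  show "parcs (complete_bipartite_graph m n)
      = {1..m} \<times> {m+1..m+n} \<union> {m+1..m+n} \<times> {1..m}"
    by (fastforce simp: complete_bipartite_graph_def ugraph_def doubleton_eq_iff)
qed (auto simp: complete_bipartite_graph_def ugraph_def)

lemma delete_edges_complete_graph:
  assumes "pverts H = {1..n}"
  shows "delete_edges (complete_graph n) H =
    \<lparr> pverts = pverts H,
      parcs = {(u, v). u \<in> pverts H \<and> v \<in> pverts H \<and> u \<noteq> v \<and> (u, v) \<notin> parcs H} \<rparr>"
proof -
  have "pverts (complete_graph n) = pverts H"
    unfolding assms by (simp add: complete_graph_def ugraph_def)
  moreover have "parcs (complete_graph n) - parcs H =
      {(u, v). u \<in> pverts H \<and> v \<in> pverts H \<and> u \<noteq> v \<and> (u, v) \<notin> parcs H}"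
    unfolding assms parcs_complete_graph by blast
  ultimately show ?thesis
    by (simp only: delete_edges_def)
qed

end

(*
  Fix a vertex v. Its red neighbourhood N contains no red triangle, and no red (hence no blue)
  pentagon, since that would give a red wheel K_6 minus C_5; so by R(3,3) = 6 and the uniqueness of
  the extremal colouring of K_5, any five red neighbours of v contain a blue triangle. Dually for
  the blue neighbours.

  A vertex v, a blue triangle A in its red neighbourhood and a red triangle T in its blue
  neighbourhood cannot coexist: in the 3 x 3 red/blue matrix between A and T, excluding K_4 and
  K_{3,2} leaves no constant row or column, excluding K_6 minus H_6 leaves no two complementary rows
  or columns, so the matrix is a permutation matrix or the complement of one; then v, A and T induce
  H_7 in one of the colours, that is K_7 minus H_7 in the other. Hence some colour has at most four
  edges at v, and the other at least seven.

  Seven red neighbours are impossible as soon as there is one more vertex x. They contain a blue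
  triangle A, the other four contain a red edge b_1 b_2, and the b_i have distinct red neighbours
  a_i in A. What remains is propositional.
*)
theory Submission
  imports Defs
begin

section \<open>Induced copies given by vertex lists\<close>

lemma has_induced_copyI:
  assumes G: "wf_digraph (with_proj G)" and F: "wf_digraph (with_proj F)"
    and inj: "inj_on f (pverts F)" and sub: "f ` pverts F \<subseteq> pverts G"
    and arc: "\<And>u v. u \<in> pverts F \<Longrightarrow> v \<in> pverts F \<Longrightarrow> (f u, f v) \<in> parcs G \<longleftrightarrow> (u, v) \<in> parcs F"
  shows "has_induced_copy G F"
proof -
  define S where "S = with_proj
    \<lparr>pverts = f ` pverts F, parcs = {e \<in> parcs G. fst e \<in> f ` pverts F \<and> snd e \<in> f ` pverts F}\<rparr>"
  \<comment> \<open>Arcs are ordered pairs, so the arc map is \<open>f\<close> on both components,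
    with \<open>fst\<close> as tail and \<open>snd\<close> as head.\<close>
  define h where "h = \<lparr>iso_verts = f, iso_arcs = map_prod f f, iso_head = snd, iso_tail = fst\<rparr>"
  have F': "u \<in> pverts F \<and> v \<in> pverts F" if "(u, v) \<in> parcs F" for u v
    using F that by (force simp: wf_digraph_def)
  have "induced_subgraph S (with_proj G)"
    using G sub
    by (auto simp: S_def induced_subgraph_def subgraph_def compatible_def wf_digraph_def)
  moreover have "digraph_iso (with_proj F) S"
    unfolding digraph_iso_def
  proof (intro exI conjI)
    show "pre_digraph.digraph_isomorphism (with_proj F) h"
      using F inj F' by (auto simp: h_def pre_digraph.digraph_isomorphism_def inj_on_def)
    show "S = app_iso h (with_proj F)"
      using arc F' by (force simp: S_def h_def with_proj_def app_iso_def image_iff)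
  qed
  \<comment> \<open>\<open>f\<close> leads from \<open>F\<close> to \<open>S\<close>, whereas
    \<open>has_induced_copy\<close> asks for an isomorphism from \<open>S\<close> to
    \<open>F\<close>.\<close>
  ultimately show ?thesis
    unfolding has_induced_copy_def using digraph_iso_swap[OF F] by blast
qed

text \<open>
  The entries of \<open>xs\<close>, indexed from 0, play the vertices 1, 2, \<dots> of \<open>F\<close>; \<open>r\<close> may be arbitrary
  on the diagonal.
\<close>
definition induced_on :: "('a \<Rightarrow> 'a \<Rightarrow> bool) \<Rightarrow> nat pair_pre_digraph \<Rightarrow> 'a list \<Rightarrow> bool" where
  "induced_on r F xs \<longleftrightarrow>
     (\<forall>i<length xs. \<forall>j<length xs. i \<noteq> j \<longrightarrow> (r (xs ! i) (xs ! j) \<longleftrightarrow> (Suc i, Suc j) \<in> parcs F))"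

definition family :: "nat pair_pre_digraph set" where
  "family = {complete_graph 4,
             complete_bipartite_graph 3 2,
             delete_edges (complete_graph 6) C5,
             delete_edges (complete_graph 6) H6,
             delete_edges (complete_graph 7) H7}"

lemma family_wf:
  assumes "F \<in> family"
  shows "wf_digraph (with_proj F)" and "(u, u) \<notin> parcs F"
  using assms
  by (auto simp: family_def wf_digraph_def delete_edges_def complete_graph_def
      complete_bipartite_graph_def complete_edges_def ugraph_def doubleton_eq_iff)

lemma has_induced_copy_if_induced_on:
  assumes ind: "induced_on r F xs" and F: "F \<in> family" and V: "pverts F = {1..length xs}"
    and xs: "distinct xs" "set xs \<subseteq> pverts G"
    and G: "wf_digraph (with_proj G)" "\<And>u. (u, u) \<notin> parcs G"
    and r: "\<And>u v. u \<in> pverts G \<Longrightarrow> v \<in> pverts G \<Longrightarrow> u \<noteq> v \<Longrightarrow> r u v \<longleftrightarrow> (u, v) \<in> parcs G"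
  shows "has_induced_copy G F"
proof (rule has_induced_copyI)
  \<comment> \<open>The vertices of \<open>F\<close> are numbered from 1, list positions from
    0.\<close>
  let ?f = "\<lambda>i. xs ! (i - 1)"
  show "wf_digraph (with_proj G)" "wf_digraph (with_proj F)"
    using G family_wf[OF F] by auto
  show "inj_on ?f (pverts F)"
    using xs(1) by (auto simp: V inj_on_def nth_eq_iff_index_eq)
  have mem: "?f u \<in> pverts G" if "u \<in> pverts F" for u
    using xs(2) that by (auto simp: V intro!: subsetD[OF xs(2)] nth_mem)
  then show "?f ` pverts F \<subseteq> pverts G"
    by auto
  fix u v assume uv: "u \<in> pverts F" "v \<in> pverts F"
  show "(?f u, ?f v) \<in> parcs G \<longleftrightarrow> (u, v) \<in> parcs F"
  proof (cases "u = v")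
    case True
    then show ?thesis using G(2) family_wf(2)[OF F] by simp
  next
    case False
    have ij: "u - 1 < length xs" "v - 1 < length xs" "u - 1 \<noteq> v - 1" "Suc (u - 1) = u" "Suc (v - 1) = v"
      using uv False by (auto simp: V)
    then have "?f u \<noteq> ?f v"
      using xs(1) by (simp add: nth_eq_iff_index_eq)
    then show ?thesis
      using ind ij r[OF mem[OF uv(1)] mem[OF uv(2)]] unfolding induced_on_def by metis
  qed
qed

section \<open>The forbidden graphs as propositional constraints\<close>

lemma pverts_family:
  "pverts (complete_graph n) = {1..n}"
  "pverts (complete_bipartite_graph m n) = {1..m+n}"
  "pverts (delete_edges (complete_graph n) H) = {1..n}"
  by (simp_all add: complete_graph_def complete_bipartite_graph_def delete_edges_def ugraph_def)

lemma parcs_complete_bipartite_graph: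
  "parcs (complete_bipartite_graph m n) = {1..m} \<times> {m+1..m+n} \<union> {m+1..m+n} \<times> {1..m}"
  by (fastforce simp: complete_bipartite_graph_def ugraph_def doubleton_eq_iff)

text \<open>Only symmetry is imposed on \<open>r\<close>, nothing on the diagonal, so that the
  negation of \<open>r\<close> can be an instance too and serve as the other colour.\<close>

locale avoiding =
  fixes V :: "'a set" and r :: "'a \<Rightarrow> 'a \<Rightarrow> bool"
  assumes sym: "r x y \<longleftrightarrow> r y x"
    and avoids: "F \<in> family \<Longrightarrow> pverts F = {1..length xs} \<Longrightarrow> distinct xs \<Longrightarrow> set xs \<subseteq> V
      \<Longrightarrow> \<not> induced_on r F xs"
begin

text \<open>By symmetry one literal per unordered pair suffices; a forbidden copy thus becomes a
  single clause.\<close>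

lemma induced_on_family:
  "induced_on r (complete_graph 4) [a,b,c,d] \<longleftrightarrow>
     r a b \<and> r a c \<and> r a d \<and> r b c \<and> r b d \<and> r c d"
  "induced_on r (complete_bipartite_graph 3 2) [a,b,c,d,e] \<longleftrightarrow>
     \<not> r a b \<and> \<not> r a c \<and> r a d \<and> r a e \<and> \<not> r b c \<and> r b d \<and> r b e \<and> r c d \<and> r c e \<and> \<not> r d e"
  "induced_on r (delete_edges (complete_graph 6) C5) [a,b,c,d,e,f] \<longleftrightarrow>
     \<not> r a b \<and> r a c \<and> r a d \<and> \<not> r a e \<and> r a f \<and> \<not> r b c \<and> r b d \<and> r b e \<and> r b f \<and>
     \<not> r c d \<and> r c e \<and> r c f \<and> \<not> r d e \<and> r d f \<and> r e f"
  "induced_on r (delete_edges (complete_graph 6) H6) [a,b,c,d,e,f] \<longleftrightarrow>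
     \<not> r a b \<and> r a c \<and> r a d \<and> \<not> r a e \<and> r a f \<and> \<not> r b c \<and> r b d \<and> r b e \<and> \<not> r b f \<and>
     \<not> r c d \<and> r c e \<and> r c f \<and> \<not> r d e \<and> r d f \<and> \<not> r e f"
  "induced_on r (delete_edges (complete_graph 7) H7) [a,b,c,d,e,f,g] \<longleftrightarrow>
     \<not> r a b \<and> \<not> r a c \<and> \<not> r a d \<and> r a e \<and> r a f \<and> r a g \<and> \<not> r b c \<and> r b d \<and> \<not> r b e \<and> r b f \<and> r b g \<and>
     r c d \<and> r c e \<and> \<not> r c f \<and> r c g \<and> r d e \<and> r d f \<and> \<not> r d g \<and> r e f \<and> \<not> r e g \<and> \<not> r f g"
  by (simp_all add: induced_on_def delete_edges_def parcs_complete_graph C5_def H6_def H7_def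
      parcs_complete_bipartite_graph ugraph_def doubleton_eq_iff All_less_Suc numeral_eq_Suc
      sym[of b a] sym[of c a] sym[of d a] sym[of e a] sym[of f a] sym[of g a] sym[of c b]
      sym[of d b] sym[of e b] sym[of f b] sym[of g b] sym[of d c] sym[of e c] sym[of f c]
      sym[of g c] sym[of e d] sym[of f d] sym[of g d] sym[of f e] sym[of g e] sym[of g f])
    safe

lemma not_induced_on_family:
  "distinct [a,b,c,d] \<Longrightarrow> {a,b,c,d} \<subseteq> V \<Longrightarrow> \<not> induced_on r (complete_graph 4) [a,b,c,d]"
  "distinct [a,b,c,d,e] \<Longrightarrow> {a,b,c,d,e} \<subseteq> V \<Longrightarrow>
     \<not> induced_on r (complete_bipartite_graph 3 2) [a,b,c,d,e]"
  "distinct [a,b,c,d,e,f] \<Longrightarrow> {a,b,c,d,e,f} \<subseteq> V \<Longrightarrow>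
     \<not> induced_on r (delete_edges (complete_graph 6) C5) [a,b,c,d,e,f]"
  "distinct [a,b,c,d,e,f] \<Longrightarrow> {a,b,c,d,e,f} \<subseteq> V \<Longrightarrow>
     \<not> induced_on r (delete_edges (complete_graph 6) H6) [a,b,c,d,e,f]"
  "distinct [a,b,c,d,e,f,g] \<Longrightarrow> {a,b,c,d,e,f,g} \<subseteq> V \<Longrightarrow>
     \<not> induced_on r (delete_edges (complete_graph 7) H7) [a,b,c,d,e,f,g]"
  by (rule avoids; simp add: family_def pverts_family)+

end

section \<open>Excluded configurations in two colours\<close>

locale two_coloured = red: avoiding V r + blue: avoiding V "\<lambda>x y. \<not> r x y"
  for V :: "'a set" and r :: "'a \<Rightarrow> 'a \<Rightarrow> bool"
begin

text \<open>Interchanging the colours makes every later result available with red and blue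
  swapped.\<close>

lemma dual: "two_coloured V (\<lambda>x y. \<not> r x y)"
  using red.avoiding_axioms blue.avoiding_axioms by (simp add: two_coloured_def)

text \<open>
  The lists of copies in the following lemmas are minimal unsatisfiable subsets of all instances,
  found with a SAT solver.
\<close>

lemma no_opposite_triangles:
  assumes D: "distinct [v,a1,a2,a3,t1,t2,t3]" "set [v,a1,a2,a3,t1,t2,t3] \<subseteq> V"
    and v: "r v a1" "r v a2" "r v a3" "\<not> r v t1" "\<not> r v t2" "\<not> r v t3"
    and a: "\<not> r a1 a2" "\<not> r a1 a3" "\<not> r a2 a3"
    and t: "r t1 t2" "r t1 t3" "r t2 t3"
  shows False
proof -
  \<comment> \<open>The reversed list supplies each inequality in the opposite orientation as
    well.\<close>
  note D = D D(1)[THEN distinct_rev[THEN iffD2]]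
  \<comment> \<open>View the edges between the \<open>a\<close>s (rows) and the \<open>t\<close>s
    (columns) as a matrix. Facts 1 and 4 exclude rows that are all red or all blue; 2 and 3 exclude
    columns that are all blue or all red.\<close>
  have 1: "\<forall>xs \<in> set
     [[a1,t1,t2,t3], [a2,t1,t2,t3], [a3,t1,t2,t3]].
    \<not> induced_on r (complete_graph 4) xs"
    using D by (simp add: red.not_induced_on_family)
  have 2: "\<forall>xs \<in> set
     [[a1,a2,a3,t1], [a1,a2,a3,t2], [a1,a2,a3,t3]].
    \<not> induced_on (\<lambda>x y. \<not> r x y) (complete_graph 4) xs"
    using D by (simp add: blue.not_induced_on_family)
  have 3: "\<forall>xs \<in> set
     [[a1,a2,a3,v,t1], [a1,a2,a3,v,t2], [a1,a2,a3,v,t3]].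
    \<not> induced_on r (complete_bipartite_graph 3 2) xs"
    using D by (simp add: red.not_induced_on_family)
  have 4: "\<forall>xs \<in> set
     [[t1,t2,t3,v,a1], [t1,t2,t3,v,a2], [t1,t2,t3,v,a3]].
    \<not> induced_on (\<lambda>x y. \<not> r x y) (complete_bipartite_graph 3 2) xs"
    using D by (simp add: blue.not_induced_on_family)
  \<comment> \<open>Each list makes the rows of its fourth and fifth vertices complementary; fact 6
    treats columns in the same way.\<close>
  have 5: "\<forall>xs \<in> set
     [[t1,v,t2,a1,a2,t3], [t1,v,t2,a1,a3,t3], [t1,v,t2,a2,a1,t3], [t1,v,t2,a2,a3,t3],
      [t1,v,t2,a3,a1,t3], [t1,v,t3,a1,a2,t2], [t1,v,t3,a1,a3,t2], [t1,v,t3,a2,a1,t2],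
      [t1,v,t3,a2,a3,t2], [t1,v,t3,a3,a1,t2], [t1,v,t3,a3,a2,t2], [t2,v,t1,a1,a2,t3],
      [t2,v,t1,a1,a3,t3], [t2,v,t1,a2,a1,t3], [t2,v,t1,a2,a3,t3], [t2,v,t1,a3,a1,t3],
      [t2,v,t1,a3,a2,t3]].
    \<not> induced_on r (delete_edges (complete_graph 6) H6) xs"
    using D by (simp add: red.not_induced_on_family)
  have 6: "\<forall>xs \<in> set
     [[a1,v,a2,t2,t1,a3], [a1,v,a2,t2,t3,a3], [a1,v,a3,t1,t2,a2], [a1,v,a3,t3,t2,a2]].
    \<not> induced_on (\<lambda>x y. \<not> r x y) (delete_edges (complete_graph 6) H6) xs"
    using D by (simp add: blue.not_induced_on_family)
  \<comment> \<open>One list per bijection between the triangles: here the blue entries form a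
    permutation matrix, in fact 8 the red ones do.\<close>
  have 7: "\<forall>xs \<in> set
     [[a1,a2,a3,t1,t2,t3,v], [a1,a2,a3,t1,t3,t2,v], [a1,a2,a3,t2,t1,t3,v], [a1,a2,a3,t2,t3,t1,v],
      [a1,a2,a3,t3,t1,t2,v], [a1,a2,a3,t3,t2,t1,v]].
    \<not> induced_on r (delete_edges (complete_graph 7) H7) xs"
    using D by (simp add: red.not_induced_on_family)
  have 8: "\<forall>xs \<in> set
     [[t1,t2,t3,a1,a2,a3,v], [t1,t2,t3,a1,a3,a2,v], [t1,t2,t3,a2,a1,a3,v], [t1,t2,t3,a2,a3,a1,v],
      [t1,t2,t3,a3,a1,a2,v], [t1,t2,t3,a3,a2,a1,v]].
    \<not> induced_on (\<lambda>x y. \<not> r x y) (delete_edges (complete_graph 7) H7) xs"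
    using D by (simp add: blue.not_induced_on_family)
  \<comment> \<open>Every pair is oriented in one way, so that \<open>sat\<close> sees one atom per
    edge.\<close>
  note sym = red.sym[of a1 v] red.sym[of a2 v] red.sym[of a3 v] red.sym[of t1 v] red.sym[of t2 v]
    red.sym[of t3 v] red.sym[of a2 a1] red.sym[of a3 a1] red.sym[of t1 a1] red.sym[of t2 a1]
    red.sym[of t3 a1] red.sym[of a3 a2] red.sym[of t1 a2] red.sym[of t2 a2] red.sym[of t3 a2]
    red.sym[of t1 a3] red.sym[of t2 a3] red.sym[of t3 a3] red.sym[of t2 t1] red.sym[of t3 t1]
    red.sym[of t3 t2]
  show ?thesis
    using 1 2 3 4 5 6 7 8 v a t
    unfolding list.set ball_simps red.induced_on_family blue.induced_on_family not_not sym
    by sat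
qed

text \<open>The hypotheses place a red path \<open>a1\<close>, \<open>b1\<close>, \<open>b2\<close>,
  \<open>a2\<close> in the neighbourhood of \<open>v\<close>, with both ends on the blue triangle.
  The colour of the edge from \<open>v\<close> to \<open>x\<close> is left open; the listed copies
  refute both cases.\<close>

lemma no_path_in_seven_neighbours:
  assumes D: "distinct [v,a1,a2,a3,b1,b2,b3,b4,x]" "set [v,a1,a2,a3,b1,b2,b3,b4,x] \<subseteq> V"
    and v: "r v a1" "r v a2" "r v a3" "r v b1" "r v b2" "r v b3" "r v b4"
    and a: "\<not> r a1 a2" "\<not> r a1 a3" "\<not> r a2 a3"
    and b: "r b1 b2" "r a1 b1" "r a2 b2"
  shows False
proof -
  note D = D D(1)[THEN distinct_rev[THEN iffD2]]
  have 1: "\<forall>xs \<in> set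
     [[v,a1,b1,b2], [v,a1,b1,b3], [v,a1,b1,b4], [v,a1,b1,x],
      [v,a1,b3,b4], [v,a1,b4,x], [v,a2,b1,b2], [v,a2,b2,b3],
      [v,a2,b2,b4], [v,a2,b2,x], [v,a2,b3,b4], [v,a3,b1,b2],
      [v,a3,b1,b3], [v,a3,b1,b4], [v,a3,b2,b3], [v,a3,b2,b4],
      [v,a3,b3,b4], [v,a3,b3,x]].
    \<not> induced_on r (complete_graph 4) xs"
    using D by (simp add: red.not_induced_on_family)
  have 2: "\<forall>xs \<in> set
     [[a1,a2,a3,b3], [a1,a2,a3,b4], [a1,a2,a3,x], [a1,a2,b3,b4],
      [a1,a3,b2,b3], [a1,a3,b2,b4], [a1,a3,b2,x], [a1,b2,b3,b4],
      [a1,b2,b3,x], [a2,a3,b1,b3], [a2,a3,b1,b4], [a2,a3,b1,x],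
      [a2,b1,b3,b4], [a2,b1,b3,x], [a2,b1,b4,x], [b1,b3,b4,x],
      [b2,b3,b4,x]].
    \<not> induced_on (\<lambda>x y. \<not> r x y) (complete_graph 4) xs"
    using D by (simp add: blue.not_induced_on_family)
  \<comment> \<open>These apply when \<open>v\<close> and \<open>x\<close> are joined in blue: a
    blue triangle of common red neighbours then gives a red \<open>K_{3,2}\<close>.\<close>
  have 3: "\<forall>xs \<in> set
     [[a1,a3,b2,v,x], [a1,b2,b3,v,x], [a2,a3,b1,v,x], [a2,b1,b3,v,x],
      [a2,b1,b4,v,x], [b1,b3,b4,v,x], [b2,b3,b4,v,x]].
    \<not> induced_on r (complete_bipartite_graph 3 2) xs"
    using D by (simp add: red.not_induced_on_family)
  have 4: "\<forall>xs \<in> set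
     [[a1,b1,x,a3,b4], [a1,b4,x,a2,b2], [a2,b2,x,a1,b4], [a2,b2,x,a3,b3],
      [a2,b4,x,a1,b3], [a3,b3,x,a2,b2], [a3,b3,x,b1,b2], [a3,b4,x,b1,b2],
      [b1,b2,x,a3,b3]].
    \<not> induced_on (\<lambda>x y. \<not> r x y) (complete_bipartite_graph 3 2) xs"
    using D by (simp add: blue.not_induced_on_family)
  \<comment> \<open>\<open>v\<close> is the hub of each red wheel, so a red pentagon among its
    neighbours is excluded.\<close>
  have 5: "\<forall>xs \<in> set
     [[a1,a2,b1,b3,b2,v], [a1,a2,b1,b4,b2,v], [a1,a3,b1,b3,b2,v], [a1,a3,b1,b3,b4,v],
      [a1,a3,b1,b4,b2,v], [a1,a3,b1,b4,b3,v], [a1,a3,b3,b1,b4,v], [a1,a3,b4,b1,b3,v],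
      [a2,a3,b2,b3,b1,v], [a2,a3,b2,b3,b4,v], [a2,a3,b2,b4,b1,v], [a2,a3,b2,b4,b3,v],
      [a2,a3,b3,b2,b4,v], [a2,a3,b4,b2,b3,v]].
    \<not> induced_on r (delete_edges (complete_graph 6) C5) xs"
    using D by (simp add: red.not_induced_on_family)
  have 6: "\<forall>xs \<in> set
     [[a1,b1,b2,a2,x,a3], [a1,b1,b2,x,b3,b4], [a1,b1,b2,x,b4,b3], [a1,b1,x,a3,b3,a2],
      [a1,b1,x,a3,b4,a2], [a1,b3,a3,b4,x,b2], [a1,b4,a3,b3,x,b2], [a2,b2,b1,x,b3,b4],
      [a2,b2,b1,x,b4,b3], [a2,b2,x,a3,b3,a1], [a2,b2,x,a3,b4,a1], [a2,b3,a3,b4,x,b1],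
      [a2,b4,a3,b3,x,b1]].
    \<not> induced_on (\<lambda>x y. \<not> r x y) (delete_edges (complete_graph 6) C5) xs"
    using D by (simp add: blue.not_induced_on_family)
  note sym = red.sym[of a1 v] red.sym[of a2 v] red.sym[of a3 v] red.sym[of b1 v] red.sym[of b2 v]
    red.sym[of b3 v] red.sym[of b4 v] red.sym[of x v] red.sym[of a2 a1] red.sym[of a3 a1]
    red.sym[of b1 a1] red.sym[of b2 a1] red.sym[of b3 a1] red.sym[of b4 a1] red.sym[of x a1]
    red.sym[of a3 a2] red.sym[of b1 a2] red.sym[of b2 a2] red.sym[of b3 a2] red.sym[of b4 a2]
    red.sym[of x a2] red.sym[of b1 a3] red.sym[of b2 a3] red.sym[of b3 a3] red.sym[of b4 a3]
    red.sym[of x a3] red.sym[of b2 b1] red.sym[of b3 b1] red.sym[of b4 b1] red.sym[of x b1]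
    red.sym[of b3 b2] red.sym[of b4 b2] red.sym[of x b2] red.sym[of b4 b3] red.sym[of x b3]
    red.sym[of x b4]
  show ?thesis
    using 1 2 3 4 5 6 v a b
    unfolding list.set ball_simps red.induced_on_family blue.induced_on_family not_not sym
    by sat
qed

section \<open>Neighbourhoods and degree bounds\<close>

lemma blue_triangle:
  assumes "v \<in> V" "S \<subseteq> V" "v \<notin> S" "5 \<le> card S" "\<And>s. s \<in> S \<Longrightarrow> r v s"
  shows "\<exists>a b c. {a,b,c} \<subseteq> S \<and> distinct [a,b,c] \<and> \<not> r a b \<and> \<not> r a c \<and> \<not> r b c"
proof -
  obtain T where "T \<subseteq> S" "card T = 5"
    using assms(4) by (meson obtain_subset_with_card_n)
  moreover from this obtain xs where "distinct xs" "set xs = T" "length xs = 5"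
    by (metis card_ge_0_finite distinct_card finite_distinct_list zero_less_numeral)
  moreover from this obtain s1 s2 s3 s4 s5 where "xs = [s1,s2,s3,s4,s5]"
    by (auto simp: length_Suc_conv numeral_eq_Suc)
  ultimately have s: "distinct [s1,s2,s3,s4,s5]" "set [s1,s2,s3,s4,s5] \<subseteq> S"
    by simp_all
  have D: "distinct [v,s1,s2,s3,s4,s5]" "set [v,s1,s2,s3,s4,s5] \<subseteq> V"
    using s assms(1-3) by auto
  note D = D D(1)[THEN distinct_rev[THEN iffD2]]
  have 1: "\<forall>xs \<in> set
     [[v,s1,s2,s3], [v,s1,s2,s4], [v,s1,s2,s5], [v,s1,s3,s4], [v,s1,s3,s5],
      [v,s1,s4,s5], [v,s2,s3,s4], [v,s2,s3,s5], [v,s2,s4,s5], [v,s3,s4,s5]].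
    \<not> induced_on r (complete_graph 4) xs"
    using D by (simp add: red.not_induced_on_family)
  \<comment> \<open>Without a monochromatic triangle the two colours form complementary pentagons.
    The lists run over all twelve 5-cycles as the blue one; the red one forms a wheel with hub
    \<open>v\<close>.\<close>
  have 2: "\<forall>xs \<in> set
     [[s1,s2,s3,s4,s5,v], [s1,s2,s3,s5,s4,v], [s1,s2,s4,s3,s5,v], [s1,s2,s4,s5,s3,v],
      [s1,s2,s5,s3,s4,v], [s1,s2,s5,s4,s3,v], [s1,s3,s2,s4,s5,v], [s1,s3,s2,s5,s4,v],
      [s1,s3,s4,s2,s5,v], [s1,s3,s5,s2,s4,v], [s1,s4,s2,s3,s5,v], [s1,s4,s3,s2,s5,v]].
    \<not> induced_on r (delete_edges (complete_graph 6) C5) xs"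
    using D by (simp add: red.not_induced_on_family)
  note sym = red.sym[of s1 v] red.sym[of s2 v] red.sym[of s3 v] red.sym[of s4 v] red.sym[of s5 v]
    red.sym[of s2 s1] red.sym[of s3 s1] red.sym[of s4 s1] red.sym[of s5 s1] red.sym[of s3 s2]
    red.sym[of s4 s2] red.sym[of s5 s2] red.sym[of s4 s3] red.sym[of s5 s3] red.sym[of s5 s4]
  show ?thesis
  proof (rule ccontr)
    assume "\<not> ?thesis"
    then have tri: "r a b \<or> r a c \<or> r b c" if "distinct [a,b,c]" "{a,b,c} \<subseteq> S" for a b c
      using that by blast
    have 3: "\<forall>(a, b, c) \<in> set [(s1,s2,s3), (s1,s2,s4), (s1,s2,s5), (s1,s3,s4), (s1,s3,s5),
        (s1,s4,s5), (s2,s3,s4), (s2,s3,s5), (s2,s4,s5), (s3,s4,s5)]. r a b \<or> r a c \<or> r b c"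
      using s by (simp add: tri)
    have v: "r v s1" "r v s2" "r v s3" "r v s4" "r v s5"
      using s(2) assms(5) by simp_all
    show False
      using 1 2 3 v unfolding list.set ball_simps prod.case red.induced_on_family sym
      by sat
  qed
qed

text \<open>Seven red neighbours and an outside vertex always yield, after renaming, the
  configuration of \<open>no_path_in_seven_neighbours\<close>.\<close>

lemma card_neighbours_neq_7:
  assumes "v \<in> V" "S \<subseteq> V" "v \<notin> S" "x \<in> V" "x \<notin> S" "x \<noteq> v" "\<And>s. s \<in> S \<Longrightarrow> r v s"
  shows "card S \<noteq> 7"
proof
  assume S: "card S = 7"
  then have "finite S"
    by (simp add: card_ge_0_finite)
  obtain a1 a2 a3 where a: "{a1,a2,a3} \<subseteq> S" "distinct [a1,a2,a3]" "\<not> r a1 a2" "\<not> r a1 a3" "\<not> r a2 a3"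
    using blue_triangle[OF assms(1-3) _ assms(7)] S by force
  let ?A = "{a1,a2,a3}" and ?B = "S - {a1,a2,a3}"
  have B: "card ?B = 4"
    using S a(1,2) \<open>finite S\<close> by (simp add: card_Diff_subset)
  \<comment> \<open>Excluding a blue \<open>K_4\<close> serves twice: it yields a red edge inside
    \<open>?B\<close>, and a red neighbour in \<open>?A\<close> for each vertex of
    \<open>?B\<close>.\<close>
  have K: "r c d \<or> r c e \<or> r c f \<or> r d e \<or> r d f \<or> r e f"
    if "distinct [c,d,e,f]" "{c,d,e,f} \<subseteq> S" for c d e f
    using blue.not_induced_on_family(1)[OF that(1)] that(2) assms(2)
    unfolding blue.induced_on_family by blast
  obtain b1 b2 where b: "b1 \<in> ?B" "b2 \<in> ?B" "b1 \<noteq> b2" "r b1 b2"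
  proof -
    obtain xs where "distinct xs" "set xs = ?B" "length xs = 4"
      using B by (metis card_ge_0_finite distinct_card finite_distinct_list zero_less_numeral)
    moreover from this obtain c d e f where "xs = [c,d,e,f]"
      by (auto simp: length_Suc_conv numeral_eq_Suc)
    ultimately have cdef: "?B = {c,d,e,f}" "distinct [c,d,e,f]"
      by auto
    have "r c d \<or> r c e \<or> r c f \<or> r d e \<or> r d f \<or> r e f"
      by (rule K) (use cdef in blast)+
    with cdef that show ?thesis
      by auto
  qed
  have "card (?B - {b1,b2}) = 2"
    using b B \<open>finite S\<close> by (simp add: card_Diff_subset)
  then obtain b3 b4 where b34: "?B - {b1,b2} = {b3,b4}" "b3 \<noteq> b4"
    by (auto simp: card_2_iff)
  have nbr: "\<exists>a\<in>?A. r a b" if "b \<in> ?B" for b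
    using K[of a1 a2 a3 b] a that by auto
  obtain c1 where c1: "c1 \<in> ?A" "r c1 b1"
    using nbr[OF b(1)] by auto
  obtain c2 where c2: "c2 \<in> ?A" "r c2 b2"
    using nbr[OF b(2)] by auto
  \<comment> \<open>A common neighbour would complete a red \<open>K_4\<close> with
    \<open>v\<close>, \<open>b1\<close> and \<open>b2\<close>.\<close>
  have "c1 \<noteq> c2"
  proof
    assume "c1 = c2"
    moreover have "distinct [v,c1,b1,b2]" "{v,c1,b1,b2} \<subseteq> V"
      using a(1) b c1(1) assms(1-3) by auto
    ultimately show False
      using red.not_induced_on_family(1)[of v c1 b1 b2] b c1 c2 a(1) assms(7)
      unfolding red.induced_on_family by auto
  qed
  then obtain c3 where c3: "c3 \<in> ?A" "c3 \<noteq> c1" "c3 \<noteq> c2" "\<not> r c1 c2" "\<not> r c1 c3" "\<not> r c2 c3"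
    using c1(1) c2(1) a(2-5) red.sym by (elim insertE emptyE) auto
  have b34': "b3 \<in> ?B" "b4 \<in> ?B" "b3 \<notin> {b1,b2}" "b4 \<notin> {b1,b2}"
    using b34(1) by blast+
  have S: "set [c1,c2,c3,b1,b2,b3,b4] \<subseteq> S"
    using a(1) b(1,2) b34' c1(1) c2(1) c3(1) by auto
  have "distinct [c1,c2,c3,b1,b2,b3,b4]"
    using b b34' b34(2) c1(1) c2(1) c3(1-3) \<open>c1 \<noteq> c2\<close> by auto
  then have "distinct [v,c1,c2,c3,b1,b2,b3,b4,x]"
    using S assms(3,5,6) by auto
  moreover have "set [v,c1,c2,c3,b1,b2,b3,b4,x] \<subseteq> V"
    using S assms(1,2,4) by auto
  ultimately show False
    by (rule no_path_in_seven_neighbours) (use S assms(7) b c1 c2 c3 in auto)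
qed

lemma card_neighbours_le_6:
  assumes "v \<in> V" "finite V" "9 \<le> card V"
  shows "card {s \<in> V - {v}. r v s} \<le> 6"
proof (rule ccontr)
  assume "\<not> ?thesis"
  then obtain S where S: "S \<subseteq> {s \<in> V - {v}. r v s}" "card S = 7"
    using obtain_subset_with_card_n[of 7 "{s \<in> V - {v}. r v s}"] by force
  \<comment> \<open>\<open>v\<close> and the seven chosen neighbours are at most eight vertices, so
    a ninth is left. It may itself be a red neighbour of \<open>v\<close>.\<close>
  have "card (insert v S) < card V"
    using S assms(3) card_insert_le_m1[of 8 S v] by simp
  then obtain x where "x \<in> V" "x \<notin> insert v S"
    by (metis S(2) card_ge_0_finite card_mono finite_insert leD subsetI zero_less_numeral)
  then show False
    using card_neighbours_neq_7[of v S x] S assms(1) by auto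
qed

lemma card_neq_12:
  assumes "finite V"
  shows "card V \<noteq> 12"
proof
  assume card: "card V = 12"
  then obtain v where v: "v \<in> V"
    by fastforce
  interpret dual: two_coloured V "\<lambda>x y. \<not> r x y"
    by (rule dual)
  let ?R = "{s \<in> V - {v}. r v s}" and ?B = "{s \<in> V - {v}. \<not> r v s}"
  have "card ?R + card ?B = card (?R \<union> ?B)"
    using assms by (subst card_Un_disjoint) auto
  also have "?R \<union> ?B = V - {v}"
    by auto
  finally have "card ?R + card ?B = 11"
    using card v assms by simp
  moreover have "card ?R \<le> 6" "card ?B \<le> 6"
    using card_neighbours_le_6 dual.card_neighbours_le_6 v card assms by auto
  \<comment> \<open>11 - 6 = 5 is exactly the size that \<open>blue_triangle\<close> requires, in
    both colours.\<close>
  ultimately have "5 \<le> card ?R" "5 \<le> card ?B"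
    by auto
  obtain a1 a2 a3 where a: "{a1,a2,a3} \<subseteq> ?R" "distinct [a1,a2,a3]" "\<not> r a1 a2" "\<not> r a1 a3" "\<not> r a2 a3"
    using blue_triangle[OF v _ _ \<open>5 \<le> card ?R\<close>] by blast
  obtain t1 t2 t3 where t: "{t1,t2,t3} \<subseteq> ?B" "distinct [t1,t2,t3]" "r t1 t2" "r t1 t3" "r t2 t3"
    using dual.blue_triangle[OF v _ _ \<open>5 \<le> card ?B\<close>] by blast
  have "distinct [v,a1,a2,a3,t1,t2,t3]" "set [v,a1,a2,a3,t1,t2,t3] \<subseteq> V"
    using a(1,2) t(1,2) v by auto
  then show False
    by (rule no_opposite_triangles) (use a t in auto)
qed

end

section \<open>Passage to edge colourings of \<open>K_12\<close>\<close>

lemma pverts_colour_graph: "pverts (colour_graph n c k) = {1..n}"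
  by (simp add: colour_graph_def ugraph_def)

lemma parcs_colour_graph:
  "(u, v) \<in> parcs (colour_graph n c k) \<longleftrightarrow> u \<in> {1..n} \<and> v \<in> {1..n} \<and> u \<noteq> v \<and> c {u, v} = k"
  by (auto simp: colour_graph_def ugraph_def complete_edges_def)

lemma wf_colour_graph: "wf_digraph (with_proj (colour_graph n c k))"
  by (auto simp: wf_digraph_def pverts_colour_graph parcs_colour_graph)

theorem theorem12:
  fixes c :: "nat set \<Rightarrow> colour"
  shows "\<exists>G \<in> {colour_graph 12 c Red, colour_graph 12 c Blue}.
         \<exists>F \<in> {complete_graph 4,
               complete_bipartite_graph 3 2,
               delete_edges (complete_graph 6) C5,
               delete_edges (complete_graph 6) H6,
               delete_edges (complete_graph 7) H7}.
           has_induced_copy G F"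
proof (rule ccontr)
  assume "\<not> ?thesis"
  then have no_copy: "\<not> has_induced_copy (colour_graph 12 c k) F" if "F \<in> family" for k F
    using that by (cases k) (auto simp: family_def)
  \<comment> \<open>Stated for an arbitrary \<open>k\<close>, to serve both colours. For u = v the
    value of \<open>c\<close> at a singleton enters, which \<open>induced_on\<close>
    ignores.\<close>
  have avoiding: "avoiding {1..12} r"
    if r: "\<And>u v. r u v \<longleftrightarrow> c {u, v} = k" for r :: "nat \<Rightarrow> nat \<Rightarrow> bool" and k
  proof
    show "r x y \<longleftrightarrow> r y x" for x y
      by (simp add: r insert_commute)
    fix F xs
    assume F: "F \<in> family" "pverts F = {1..length xs}" and xs: "distinct xs" "set xs \<subseteq> {1..(12::nat)}"
    show "\<not> induced_on r F xs"
    proof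
      assume "induced_on r F xs"
      then have "has_induced_copy (colour_graph 12 c k) F"
        by (rule has_induced_copy_if_induced_on[OF _ F xs(1)])
          (use xs(2) in \<open>auto simp: wf_colour_graph pverts_colour_graph parcs_colour_graph r\<close>)
      with no_copy F(1) show False by blast
    qed
  qed
  have "c e \<noteq> Red \<longleftrightarrow> c e = Blue" for e
    by (cases "c e") auto
  then interpret two_coloured "{1..12}" "\<lambda>u v. c {u, v} = Red"
    using avoiding[of "\<lambda>u v. c {u, v} = Red" Red] avoiding[of "\<lambda>u v. c {u, v} \<noteq> Red" Blue]
    by (simp add: two_coloured_def)
  show False
    using card_neq_12 by simp
qed

end
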